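(* Any function $f \in C[0,1]$ can be written as a sum $f = f_1 + f_2$, where $f_1, f_2 \in C[0,1]$ are functions such that, for every Borel probability measure $\mu$ supported on either $G_{f_1}$ or $G_{f_2}$, the Fourier transform $\widehat{\mu}(\xi)$ does not tend to $0$ as $|\xi| \to \infty$.
   Context: $C[0,1]$ is the space of continuous functions $f:[0,1]\to\mathbb{R}$. For $f\in C[0,1]$, $G_f := \{(x,f(x)) : x \in [0,1]\} \subset \mathbb{R}^2$ is its graph. For a Borel probability measure $\mu$ on $\mathbb{R}^2$, $\widehat{\mu}(\xi) := \int_{\mathbb{R}^2} e^{-2\pi i x\cdot \xi}\, d\mu(x)$, $\xi \in \mathbb{R}^2$. *)

theory Defs
  imports "HOL-Probability.Probability"
begin

text \<open>The plane is \<^typ>\<open>real \<times> real\<close>, whose norm and inner product are the Euclidean ones;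
  an element of $C[0,1]$ is a function on the reals that is continuous on the unit interval, and
  its values elsewhere are irrelevant.\<close>

definition graph_on :: "'a set \<Rightarrow> ('a \<Rightarrow> 'b) \<Rightarrow> ('a \<times> 'b) set" where
  "graph_on S f = (\<lambda>x. (x, f x)) ` S"

definition borel_probability :: "'a::topological_space measure \<Rightarrow> bool" where
  "borel_probability \<mu> \<longleftrightarrow> sets \<mu> = sets borel \<and> prob_space \<mu>"

text \<open>The complement of \<open>S\<close> is a null set. For closed \<open>S\<close> in the plane, such as the graph of a
  function in $C[0,1]$, this says that the topological support of the measure lies in \<open>S\<close>.\<close>

definition supported_on :: "'a measure \<Rightarrow> 'a set \<Rightarrow> bool" where
  "supported_on \<mu> S \<longleftrightarrow> (AE x in \<mu>. x \<in> S)"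

definition fourier_transform :: "'a::real_inner measure \<Rightarrow> 'a \<Rightarrow> complex" where
  "fourier_transform \<mu> \<xi> = (\<integral>x. exp (- 2 * of_real pi * \<i> * of_real (x \<bullet> \<xi>)) \<partial>\<mu>)"

end

theory Submission
  imports Defs
begin

text \<open>Put \<open>P t = cos (2 \<pi> t) + cos (4 \<pi> t)\<close>, so that \<open>P \<ge> - 9 / 8\<close> everywhere while \<open>P\<close> is close
  to 2 near the integers. If for every point \<open>(x, y)\<close> of a graph \<open>K x\<close> or \<open>K y\<close> is close to an
  integer, then \<open>P (K x) + P (K y) > 1 / 2\<close> on the graph; integrating against a probability measure
  on it shows that the Fourier transform exceeds \<open>1 / 8\<close> at one of the frequencies \<open>(K, 0)\<close>,
  \<open>(2 K, 0)\<close>, \<open>(0, K)\<close>, \<open>(0, 2 K)\<close>. The functions for which this happens for arbitrarily large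
  \<open>K\<close> form a dense \<open>G\<^sub>\<delta>\<close>: a continuous function is uniformly close to a staircase whose treads lie
  at heights in \<open>\<int> / K\<close> and whose steep parts lie over small neighbourhoods of \<open>\<int> / K\<close>. By Baire,
  this set \<open>R\<close> meets \<open>f - R\<close>.\<close>

section \<open>A trigonometric polynomial peaking at the integers\<close>

definition two_cos :: "real \<Rightarrow> real" where
  "two_cos t = cos (2 * pi * t) + cos (2 * pi * (2 * t))"

text \<open>Completing the square in \<open>cos (2 * pi * t)\<close>. A single cosine would be
  useless, since its minimum -1 cancels its maximum 1; with the second harmonic, one integer
  argument already forces a sum of two values up to at least 2 - 9/8 = 7/8.\<close>

lemma two_cos_ge: "two_cos t \<ge> - 9 / 8"
proof -
  define c where "c = cos (2 * pi * t)"
  have "two_cos t = 2 * c\<^sup>2 + c - 1"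
    using cos_double_cos[of "2 * pi * t"] by (simp add: two_cos_def c_def algebra_simps)
  also have "\<dots> = 2 * (c + 1 / 4)\<^sup>2 - 9 / 8"
    by (simp add: power2_eq_square algebra_simps)
  finally show ?thesis by simp
qed

lemma abs_cos_diff_le: "\<bar>cos a - cos b\<bar> \<le> \<bar>a - b\<bar>" for a b :: real
proof -
  have "\<bar>cos a - cos b\<bar> = 2 * \<bar>sin ((a + b) / 2)\<bar> * \<bar>sin ((b - a) / 2)\<bar>"
    by (simp add: cos_diff_cos abs_mult)
  also have "\<dots> \<le> 2 * 1 * \<bar>(b - a) / 2\<bar>"
    by (intro mult_mono abs_sin_x_le_abs_x) auto
  finally show ?thesis by simp
qed

lemma two_cos_lipschitz: "\<bar>two_cos s - two_cos t\<bar> \<le> 24 * \<bar>s - t\<bar>"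
proof -
  have "\<bar>two_cos s - two_cos t\<bar> \<le> \<bar>2 * pi * s - 2 * pi * t\<bar> + \<bar>2 * pi * (2 * s) - 2 * pi * (2 * t)\<bar>"
    unfolding two_cos_def
    by (intro order_trans[OF abs_diff_triangle_ineq] add_mono abs_cos_diff_le)
  also have "\<dots> = 6 * pi * \<bar>s - t\<bar>"
    by (simp add: right_diff_distrib[symmetric] abs_mult)
  also have "\<dots> \<le> 24 * \<bar>s - t\<bar>"
    using pi_less_4 by (intro mult_right_mono) auto
  finally show ?thesis .
qed

lemma two_cos_Ints: "t \<in> \<int> \<Longrightarrow> two_cos t = 2"
  using cos_integer_2pi[of t] cos_integer_2pi[of "2 * t"] by (simp add: two_cos_def)

section \<open>Staircase functions\<close>

definition ramp :: "real \<Rightarrow> real" where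
  "ramp t = max 0 (min 1 t)"

text \<open>For 0 < \<open>d\<close> \<le> 1 the graph starts at height \<open>q 0\<close> and
  climbs linearly from \<open>q j\<close> to \<open>q (Suc j)\<close> over [j+1, j+1+d]. As a sum of
  ramps it is visibly continuous, and raising \<open>m\<close> by one adds one step.\<close>

definition staircase :: "real \<Rightarrow> (nat \<Rightarrow> real) \<Rightarrow> nat \<Rightarrow> real \<Rightarrow> real" where
  "staircase d q m t = q 0 + (\<Sum>j<m. (q (Suc j) - q j) * ramp ((t - real (Suc j)) / d))"

lemma continuous_on_staircase: "continuous_on A (staircase d q m)"
  unfolding staircase_def ramp_def divide_inverse by (intro continuous_intros)

lemma staircase_integer_or_near:
  assumes "\<And>j. q j \<in> \<int>" "d > 0"
  shows "staircase d q m t \<in> \<int> \<or> (\<exists>i\<in>\<int>. \<bar>t - i\<bar> \<le> d)"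
proof (cases "\<exists>j<m. 0 < t - real (Suc j) \<and> t - real (Suc j) < d")
  case True
  then obtain j where "0 < t - real (Suc j)" "t - real (Suc j) < d" by auto
  then show ?thesis
    by (intro disjI2 bexI[of _ "real (Suc j)"]) (auto intro: Ints_of_nat)
next
  case False
  \<comment> \<open>Off the steep parts every ramp is 0 or 1, so an integer combination of integers
    remains.\<close>
  then have "ramp ((t - real (Suc j)) / d) \<in> \<int>" if "j < m" for j
    using that assms(2) by (force simp: ramp_def max_def min_def divide_simps)
  then show ?thesis
    unfolding staircase_def using assms(1)
    by (intro disjI1 Ints_add Ints_sum Ints_mult Ints_diff) auto
qed

lemma staircase_top:
  assumes "t \<ge> real m + d" "d > 0"
  shows "staircase d q m t = q m"
  using assms
proof (induction m)
  case 0
  then show ?case by (simp add: staircase_def)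
next
  case (Suc m)
  then have "ramp ((t - real (Suc m)) / d) = 1"
    by (simp add: ramp_def)
  with Suc show ?case by (simp add: staircase_def)
qed

text \<open>The value at \<open>t\<close> is a convex combination of at most two heights
  \<open>q i\<close> whose indices lie within 2 of \<open>t\<close>.\<close>

lemma staircase_close:
  assumes "0 \<le> t" "t \<le> real m + 1" "0 < d" "d \<le> 1"
    and "\<And>i. i \<le> m \<Longrightarrow> \<bar>real i - t\<bar> \<le> 2 \<Longrightarrow> \<bar>q i - y\<bar> \<le> e"
  shows "\<bar>staircase d q m t - y\<bar> \<le> e"
  using assms
proof (induction m)
  case 0
  then show ?case by (simp add: staircase_def)
next
  case (Suc m)
  define r where "r = ramp ((t - real (Suc m)) / d)"
  have eq: "staircase d q (Suc m) t = staircase d q m t + (q (Suc m) - q m) * r"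
    by (simp add: staircase_def r_def)
  show ?case
  proof (cases "t \<le> real (Suc m)")
    case True
    then have "r = 0" using \<open>0 < d\<close> by (simp add: r_def ramp_def max_def divide_simps)
    moreover have "\<bar>staircase d q m t - y\<bar> \<le> e"
      using True Suc.prems by (intro Suc.IH) auto
    ultimately show ?thesis using eq by simp
  next
    case False
    \<comment> \<open>Since \<open>d\<close> \<le> 1, the earlier steps are all complete before the
      last one begins.\<close>
    then have "staircase d q m t = q m"
      using Suc.prems by (intro staircase_top) auto
    then have "staircase d q (Suc m) t - y = (1 - r) * (q m - y) + r * (q (Suc m) - y)"
      using eq by (simp add: algebra_simps)
    also have "\<bar>\<dots>\<bar> \<le> (1 - r) * \<bar>q m - y\<bar> + r * \<bar>q (Suc m) - y\<bar>"
    proof -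
      have "0 \<le> r" "r \<le> 1" by (auto simp: r_def ramp_def)
      then show ?thesis
        by (intro order_trans[OF abs_triangle_ineq]) (simp add: abs_mult)
    qed
    also have "\<dots> \<le> (1 - r) * e + r * e"
    proof -
      have "0 \<le> r" "r \<le> 1" by (auto simp: r_def ramp_def)
      moreover have "\<bar>q m - y\<bar> \<le> e" "\<bar>q (Suc m) - y\<bar> \<le> e"
        using False Suc.prems by auto
      ultimately show ?thesis by (intro add_mono mult_left_mono) auto
    qed
    finally show ?thesis by (simp add: algebra_simps)
  qed
qed

section \<open>Resonant functions: openness and density\<close>

text \<open>Clamping the argument moves C[0,1] into the bounded continuous functions on the line, a
  complete metric space where Baire's theorem applies.\<close>

lemma bcontfun_extension:
  fixes f :: "real \<Rightarrow> real"
  assumes "continuous_on {0..1} f"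
  obtains F :: "real \<Rightarrow>\<^sub>C real" where "\<And>x. F x = f (max 0 (min 1 x))"
proof -
  have *: "f (max 0 (min 1 x)) \<in> f ` {0..1}" for x by auto
  have "continuous_on UNIV (\<lambda>x. f (max 0 (min 1 x)))"
    by (rule continuous_on_compose2[OF assms]) (auto intro!: continuous_intros)
  moreover have "bounded (range (\<lambda>x. f (max 0 (min 1 x))))"
    using * by (intro bounded_subset[OF compact_imp_bounded[OF compact_continuous_image[OF assms]]]) auto
  ultimately have "(\<lambda>x. f (max 0 (min 1 x))) \<in> bcontfun"
    by (simp add: bcontfun_def)
  then show ?thesis by (intro that[of "Bcontfun (\<lambda>x. f (max 0 (min 1 x)))"]) (simp add: Bcontfun_inverse)
qed

text \<open>The threshold 1/2 is four times the bound 1/8 used for the Fourier transform. The margin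
  \<open>c\<close>, uniform in \<open>x\<close>, leaves room for perturbation, and
  \<open>K > n\<close> makes \<open>K\<close> unbounded for a function in every
  \<open>resonant n\<close>.\<close>

definition resonant :: "nat \<Rightarrow> (real \<Rightarrow>\<^sub>C real) set" where
  "resonant n = {h :: real \<Rightarrow>\<^sub>C real. \<exists>K>n. \<exists>c>1/2. \<forall>x\<in>{0..1}.
    c \<le> two_cos (real K * x) + two_cos (real K * h x)}"

lemma resonantI:
  fixes h :: "real \<Rightarrow>\<^sub>C real"
  assumes "K > n" "c > 1/2"
    and "\<And>x. x \<in> {0..1} \<Longrightarrow> c \<le> two_cos (real K * x) + two_cos (real K * h x)"
  shows "h \<in> resonant n"
  using assms unfolding resonant_def by blast

lemma open_resonant: "open (resonant n)"
  unfolding open_dist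
proof
  fix h assume "h \<in> resonant n"
  then obtain K :: nat and c where K: "K > n" and c: "c > 1 / 2"
    and h: "\<And>x. x \<in> {0..1} \<Longrightarrow> c \<le> two_cos (real K * x) + two_cos (real K * h x)"
    by (auto simp: resonant_def)
  \<comment> \<open>Half of the margin is kept; \<open>e\<close> is such that the Lipschitz bound 24
    K e uses up exactly the other half.\<close>
  define c' where "c' = (c + 1 / 2) / 2"
  define e where "e = (c - c') / (24 * K)"
  have "e > 0" using K c by (simp add: e_def c'_def)
  moreover have "g \<in> resonant n" if "dist g h < e" for g
  proof -
    have "c' \<le> two_cos (real K * x) + two_cos (real K * g x)" if x: "x \<in> {0..1}" for x
    proof -
      have "\<bar>g x - h x\<bar> \<le> e"
        using dist_bounded[of g x h] \<open>dist g h < e\<close> by (simp add: dist_real_def)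
      then have "24 * \<bar>real K * g x - real K * h x\<bar> \<le> 24 * (real K * e)"
        by (simp add: right_diff_distrib[symmetric] abs_mult mult_left_mono)
      also have "\<dots> = c - c'" using K by (simp add: e_def)
      finally show ?thesis
        using two_cos_lipschitz[of "real K * g x" "real K * h x"] h[OF x] by linarith
    qed
    moreover have "c' > 1 / 2" using c by (simp add: c'_def)
    ultimately show ?thesis using resonantI[OF K] by blast
  qed
  ultimately show "\<exists>e>0. \<forall>g. dist g h < e \<longrightarrow> g \<in> resonant n" by blast
qed

lemma resonant_dense:
  fixes h :: "real \<Rightarrow>\<^sub>C real"
  assumes "e > 0"
  shows "\<exists>g\<in>resonant n. dist g h < e"
proof -
  have cont: "continuous_on A h" for A
    by (rule continuous_on_apply_bcontfun)
  have "uniformly_continuous_on {0..1} h"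
    by (intro compact_uniformly_continuous cont) auto
  then obtain d where "d > 0" and d: "\<And>x y. x \<in> {0..1} \<Longrightarrow> y \<in> {0..1} \<Longrightarrow> \<bar>x - y\<bar> < d
      \<Longrightarrow> \<bar>h x - h y\<bar> < e / 4"
    unfolding uniformly_continuous_on_def dist_real_def
    using assms by (metis zero_less_divide_iff zero_less_numeral)
  \<comment> \<open>\<open>2 / K < d\<close> keeps nodes i/K with |i - Kx| \<le> 2 within the
    modulus of continuity; \<open>4 / K < e\<close> makes a rounding error of 1 at most K
    e/4.\<close>
  obtain K :: nat where K: "real K > max (real n) (max (2 / d) (4 / e))"
    using reals_Archimedean2 by blast
  then have "K > n" "K > 0" "2 / K < d" "4 / K < e"
    using \<open>d > 0\<close> \<open>e > 0\<close> by (auto simp: field_simps)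
  \<comment> \<open>Rounding the node values to integers makes
    \<open>staircase_integer_or_near\<close> applicable; dividing by \<open>K\<close> returns to the
    scale of \<open>h\<close>.\<close>
  define q where "q i = real_of_int \<lfloor>real K * h (real i / real K)\<rfloor>" for i :: nat
  define S where "S x = staircase (1 / 100) q K (real K * x) / K" for x
  have "continuous_on {0..1} (\<lambda>x. S x - h x)"
    unfolding S_def
    by (intro continuous_intros cont continuous_on_compose2[OF continuous_on_staircase[of UNIV]])
      (use \<open>K > 0\<close> in auto)
  \<comment> \<open>The distance is a supremum over the whole line, so \<open>h\<close> is corrected
    by a clamped difference, which stays small outside [0,1] too.\<close>
  then obtain D :: "real \<Rightarrow>\<^sub>C real" where D: "\<And>x. D x = S (max 0 (min 1 x)) - h (max 0 (min 1 x))"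
    using bcontfun_extension by blast
  have close: "\<bar>S x - h x\<bar> \<le> e / 2" if x: "x \<in> {0..1}" for x
  proof -
    \<comment> \<open>The error K e/2 splits evenly between uniform continuity and rounding.\<close>
    have *: "\<bar>staircase (1 / 100) q K (real K * x) - real K * h x\<bar> \<le> real K * (e / 2)"
    proof (rule staircase_close)
      show "0 \<le> real K * x" "real K * x \<le> real K + 1"
        using x mult_left_mono[of x 1 "real K"] by auto
      fix i assume "i \<le> K" and i: "\<bar>real i - real K * x\<bar> \<le> 2"
      have "real i / K - x = (real i - real K * x) / K"
        using \<open>K > 0\<close> by (simp add: field_simps)
      then have "\<bar>real i / real K - x\<bar> = \<bar>real i - real K * x\<bar> / K"
        by (simp add: abs_divide)
      also have "\<dots> \<le> 2 / real K" using i by (simp add: divide_right_mono)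
      finally have "\<bar>h (real i / real K) - h x\<bar> < e / 4"
        using \<open>2 / K < d\<close> \<open>i \<le> K\<close> \<open>K > 0\<close> x by (intro d) auto
      then have "real K * \<bar>h (real i / real K) - h x\<bar> \<le> real K * (e / 4)"
        by (intro mult_left_mono) auto
      then have "\<bar>real K * h (real i / real K) - real K * h x\<bar> \<le> real K * (e / 4)"
        by (simp add: right_diff_distrib[symmetric] abs_mult)
      moreover have "1 \<le> real K * (e / 4)"
        using \<open>4 / K < e\<close> \<open>K > 0\<close> by (simp add: field_simps)
      moreover have "\<bar>q i - real K * h (real i / real K)\<bar> \<le> 1"
        unfolding q_def by linarith
      ultimately show "\<bar>q i - real K * h x\<bar> \<le> real K * (e / 2)" by linarith
    qed auto
    have "S x - h x = (staircase (1 / 100) q K (real K * x) - real K * h x) / K"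
      using \<open>K > 0\<close> by (simp add: S_def field_simps)
    then have "\<bar>S x - h x\<bar> = \<bar>staircase (1 / 100) q K (real K * x) - real K * h x\<bar> / K"
      by (simp add: abs_divide)
    also have "\<dots> \<le> real K * (e / 2) / K"
      using * by (intro divide_right_mono) auto
    finally show ?thesis using \<open>K > 0\<close> by simp
  qed
  have "\<bar>D x\<bar> \<le> e / 2" for x
    unfolding D by (rule close) auto
  then have "dist (h + D) h \<le> e / 2"
    by (intro dist_bound) (simp add: dist_real_def)
  moreover have "h + D \<in> resonant n"
  proof -
    \<comment> \<open>The worse case is an argument within 1/100 of an integer: 2 - 24/100 - 9/8 =
      0.635.\<close>
    have "6 / 10 \<le> two_cos (real K * x) + two_cos (real K * (h + D) x)" if x: "x \<in> {0..1}" for x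
    proof -
      have "(h + D) x = S x" using x by (simp add: D)
      then have eq: "real K * (h + D) x = staircase (1 / 100) q K (real K * x)"
        using \<open>K > 0\<close> by (simp add: S_def)
      have "staircase (1 / 100) q K (real K * x) \<in> \<int> \<or> (\<exists>i\<in>\<int>. \<bar>real K * x - i\<bar> \<le> 1 / 100)"
        by (rule staircase_integer_or_near) (auto simp: q_def)
      then show ?thesis
      proof
        assume "staircase (1 / 100) q K (real K * x) \<in> \<int>"
        then show ?thesis using eq two_cos_Ints two_cos_ge[of "real K * x"] by simp
      next
        assume "\<exists>i\<in>\<int>. \<bar>real K * x - i\<bar> \<le> 1 / 100"
        then obtain i where "i \<in> \<int>" "\<bar>real K * x - i\<bar> \<le> 1 / 100" by blast
        then have "\<bar>two_cos (real K * x) - 2\<bar> \<le> 24 / 100"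
          using two_cos_lipschitz[of "real K * x" i] two_cos_Ints[of i] by simp
        then have "- (two_cos (real K * x) - 2) \<le> 24 / 100"
          by (rule abs_le_D2)
        then show ?thesis
          using two_cos_ge[of "real K * (h + D) x"] by simp
      qed
    qed
    then show ?thesis using resonantI[OF \<open>K > n\<close>, of "6 / 10"] by simp
  qed
  ultimately show ?thesis using assms by (intro bexI[of _ "h + D"]) auto
qed

section \<open>Measures on resonant graphs\<close>

lemma resonant_not_rajchman:
  fixes h :: "real \<Rightarrow>\<^sub>C real" and \<mu> :: "(real \<times> real) measure"
  assumes h: "\<And>n. h \<in> resonant n"
    and \<mu>: "borel_probability \<mu>" "supported_on \<mu> (graph_on {0..1} h)"
  shows "\<not> (fourier_transform \<mu> \<longlongrightarrow> 0) at_infinity"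
proof
  assume lim: "(fourier_transform \<mu> \<longlongrightarrow> 0) at_infinity"
  interpret prob_space \<mu> using \<mu> by (simp add: borel_probability_def)
  have sets: "sets \<mu> = sets borel" using \<mu> by (simp add: borel_probability_def)
  have meas: "g \<in> borel_measurable \<mu>" if "continuous_on UNIV g"
    for g :: "real \<times> real \<Rightarrow> 'b::topological_space"
    using borel_measurable_continuous_onI[OF that] measurable_cong_sets[OF sets refl] by blast
  have int_cos: "integrable \<mu> (\<lambda>p. cos (2 * pi * (p \<bullet> \<xi>)))" for \<xi>
    by (rule integrable_const_bound[of _ 1]) (auto intro!: meas continuous_intros)
  have Re_ft: "Re (fourier_transform \<mu> \<xi>) = expectation (\<lambda>p. cos (2 * pi * (p \<bullet> \<xi>)))" for \<xi>
  proof -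
    have "integrable \<mu> (\<lambda>p. exp (- 2 * of_real pi * \<i> * of_real (p \<bullet> \<xi>)))"
      by (rule integrable_const_bound[of _ 1]) (auto intro!: meas continuous_intros)
    then have "Re (fourier_transform \<mu> \<xi>)
        = expectation (\<lambda>p. Re (exp (- 2 * of_real pi * \<i> * of_real (p \<bullet> \<xi>))))"
      unfolding fourier_transform_def by (rule integral_Re[symmetric])
    then show ?thesis by (simp add: Re_exp)
  qed
  from lim have "eventually (\<lambda>\<xi>. norm (fourier_transform \<mu> \<xi>) < 1 / 8) at_infinity"
    using tendstoD[of _ "0::complex" _ "1 / 8"] by simp
  then obtain b where b: "\<And>\<xi>. norm \<xi> \<ge> b \<Longrightarrow> norm (fourier_transform \<mu> \<xi>) < 1 / 8"
    by (auto simp: eventually_at_infinity)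
  obtain K :: nat and c where K: "K > nat \<lceil>b\<rceil>" and c: "c > 1 / 2"
    and hK: "\<And>x. x \<in> {0..1} \<Longrightarrow> c \<le> two_cos (real K * x) + two_cos (real K * h x)"
    using h[of "nat \<lceil>b\<rceil>"] by (auto simp: resonant_def)
  \<comment> \<open>At \<open>(x, h x)\<close> this is the resonant sum, while its expectation is
    the sum of four real parts of the transform.\<close>
  define P where "P p = cos (2 * pi * (p \<bullet> (real K, 0))) + cos (2 * pi * (p \<bullet> (2 * real K, 0)))
      + (cos (2 * pi * (p \<bullet> (0, real K))) + cos (2 * pi * (p \<bullet> (0, 2 * real K))))" for p :: "real \<times> real"
  have "AE p in \<mu>. p \<in> graph_on {0..1} h"
    using \<mu> by (simp add: supported_on_def)
  then have "AE p in \<mu>. c \<le> P p"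
  proof (rule AE_mp, intro AE_I2 impI)
    fix p assume "p \<in> graph_on {0..1} h"
    then obtain x where "x \<in> {0..1}" "p = (x, h x)"
      by (auto simp: graph_on_def)
    then show "c \<le> P p"
      using hK[of x] by (simp add: P_def two_cos_def mult_ac)
  qed
  moreover have "integrable \<mu> P"
    unfolding P_def by (intro Bochner_Integration.integrable_add int_cos)
  ultimately have "c \<le> expectation P" by (intro integral_ge_const)
  also have "expectation P = Re (fourier_transform \<mu> (real K, 0)) + Re (fourier_transform \<mu> (2 * real K, 0))
      + (Re (fourier_transform \<mu> (0, real K)) + Re (fourier_transform \<mu> (0, 2 * real K)))"
    unfolding P_def Re_ft by (simp add: int_cos del: inner_Pair)
  finally have "c \<le> \<dots>" .
  \<comment> \<open>All four frequencies have norm at least \<open>K\<close>, hence at least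
    \<open>b\<close>, so the four real parts add up to less than 1/2.\<close>
  moreover have "Re (fourier_transform \<mu> \<xi>) < 1 / 8" if "norm \<xi> \<ge> K" for \<xi>
  proof -
    have "b \<le> K" using K by linarith
    then show ?thesis using b[of \<xi>] that complex_Re_le_cmod[of "fourier_transform \<mu> \<xi>"] by linarith
  qed
  from this[of "(real K, 0)"] this[of "(2 * real K, 0)"] this[of "(0, real K)"] this[of "(0, 2 * real K)"]
  have "Re (fourier_transform \<mu> (real K, 0)) + Re (fourier_transform \<mu> (2 * real K, 0))
      + (Re (fourier_transform \<mu> (0, real K)) + Re (fourier_transform \<mu> (0, 2 * real K))) < 1 / 2"
    by simp
  ultimately show False using c by linarith
qed

section \<open>Baire category and the decomposition\<close>

lemma Baire_complete_space:
  fixes U :: "nat \<Rightarrow> 'a::complete_space set"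
  assumes "\<And>n. open (U n)" "\<And>n. closure (U n) = UNIV"
  shows "(\<Inter>n. U n) \<noteq> {}"
proof -
  have "Met_TC.mtopology closure_of (\<Inter>(range U)) = UNIV"
    by (rule Met_TC.metric_Baire_category)
      (use assms in \<open>auto simp: complete_UNIV\<close>)
  then show ?thesis by auto
qed

lemma bcontfun_resonant_decomposition:
  fixes F :: "real \<Rightarrow>\<^sub>C real"
  obtains h where "\<And>n. h \<in> resonant n" "\<And>n. F - h \<in> resonant n"
proof -
  \<comment> \<open>Even and odd indices interleave the conditions on \<open>h\<close> and on
    \<open>F - h\<close> into one sequence.\<close>
  define U where "U n = (if even n then resonant (n div 2) else (\<lambda>h. F - h) -` resonant (n div 2))" for n
  have "open (U n)" for n
    by (auto simp: U_def intro!: open_resonant open_vimage continuous_intros)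
  moreover have "closure (U n) = UNIV" for n
  proof -
    have "\<exists>g\<in>U n. dist g h < e" if e: "e > 0" for h e
    proof (cases "even n")
      case True
      then show ?thesis using resonant_dense[OF e] by (simp add: U_def)
    next
      case False
      obtain g where "g \<in> resonant (n div 2)" "dist g (F - h) < e"
        using resonant_dense[OF e] by blast
      \<comment> \<open>The reflection g -> \<open>F - g\<close> is an isometric involution, so it
        carries density over.\<close>
      moreover have "dist (F - g) h = dist g (F - h)"
        using norm_minus_commute[of "F - h" g] by (simp add: dist_norm algebra_simps)
      ultimately show ?thesis using False by (intro bexI[of _ "F - g"]) (simp_all add: U_def)
    qed
    then show ?thesis by (auto simp: closure_approachable)
  qed
  ultimately have "(\<Inter>n. U n) \<noteq> {}"
    by (rule Baire_complete_space)
  then obtain h where h: "\<And>n. h \<in> U n"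
    by auto
  show ?thesis
  proof (rule that)
    show "h \<in> resonant n" for n using h[of "2 * n"] by (simp add: U_def)
    show "F - h \<in> resonant n" for n using h[of "2 * n + 1"] by (simp add: U_def)
  qed
qed

theorem corollary1p1:
  fixes f :: "real \<Rightarrow> real"
  assumes "continuous_on {0..1} f"
  shows "\<exists>f1 f2 :: real \<Rightarrow> real.
    continuous_on {0..1} f1 \<and> continuous_on {0..1} f2 \<and>
    (\<forall>x\<in>{0..1}. f x = f1 x + f2 x) \<and>
    (\<forall>\<mu> :: (real \<times> real) measure.
      borel_probability \<mu> \<and>
      (supported_on \<mu> (graph_on {0..1} f1) \<or> supported_on \<mu> (graph_on {0..1} f2)) \<longrightarrow>
      \<not> (fourier_transform \<mu> \<longlongrightarrow> 0) at_infinity)"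
proof -
  obtain F :: "real \<Rightarrow>\<^sub>C real" where F: "\<And>x. F x = f (max 0 (min 1 x))"
    using bcontfun_extension[OF assms] by blast
  obtain h where h: "\<And>n. h \<in> resonant n" "\<And>n. F - h \<in> resonant n"
    using bcontfun_resonant_decomposition by blast
  have cont: "continuous_on {0..1} g" for g :: "real \<Rightarrow>\<^sub>C real"
    by (rule continuous_on_apply_bcontfun)
  show ?thesis
  proof (intro exI conjI ballI allI impI)
    \<comment> \<open>The summands are \<open>h\<close> and \<open>F - h\<close>; clamping is the
      identity on [0,1], so there \<open>F\<close> agrees with \<open>f\<close>.\<close>
    show "continuous_on {0..1} h" "continuous_on {0..1} (F - h)" by (rule cont)+
    show "f x = h x + (F - h) x" if "x \<in> {0..1}" for x using that by (simp add: F)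
    fix \<mu> :: "(real \<times> real) measure"
    assume "borel_probability \<mu> \<and>
      (supported_on \<mu> (graph_on {0..1} h) \<or> supported_on \<mu> (graph_on {0..1} (F - h)))"
    then show "\<not> (fourier_transform \<mu> \<longlongrightarrow> 0) at_infinity"
      using resonant_not_rajchman[OF h(1)] resonant_not_rajchman[OF h(2)] by blast
  qed
qed

end
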